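(* Let $(X,\rho,W)$ be a hyperbolic space, $C\subseteq X$ a nonempty convex subset, $(M,d)$ a metric space with the AFPP for nonexpansive mappings, $H:=(C\times M)_\infty$, $\delta:M\to C$ a nonexpansive function, and $T:H\to H$ a nonexpansive function. For $u\in M$ let $T_u:C\to C$, $T_u(x)=(P_1\circ T)(x,u)$. Assume that $$\sup_{u\in M} r_C(T_u)<\infty,$$ and that $\varphi:(0,\infty)\to(0,\infty)$ is such that for each $\varepsilon>0$ and each $v\in M$ there exists $x^*\in C$ satisfying $$\rho(\delta(v),x^* )\le\varphi(\varepsilon)\quad\text{and}\quad \rho(x^*,T_v(x^* ))\le \sup_{u\in M} r_C(T_u)+\varepsilon.$$ Then $$r_H(T)\le \sup_{u\in M} r_C(T_u).$$
   Context: A hyperbolic space is a triple $(X,\rho,W)$ where $(X,\rho)$ is a metric space and $W:X\times X\times[0,1]\to X$ satisfies, for all $x,y,z,w\in X$ and $\lambda,\tilde\lambda\in[0,1]$: (W1) $\rho(z,W(x,y,\lambda))\le(1-\lambda)\rho(z,x)+\lambda\rho(z,y)$; (W2) $\rho(W(x,y,\lambda),W(x,y,\tilde\lambda))=|\lambda-\tilde\lambda|\,\rho(x,y)$; (W3) $W(x,y,\lambda)=W(y,x,1-\lambda)$; (W4) $\rho(W(x,z,\lambda),W(y,w,\lambda))\le(1-\lambda)\rho(x,y)+\lambda\rho(z,w)$. A subset $C\subseteq X$ is convex if $W(x,y,\lambda)\in C$ for all $x,y\in C$, $\lambda\in[0,1]$. A map $T$ between metric spaces is nonexpansive if it does not increase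 distances (1-Lipschitz). For a self-map $T:Y\to Y$ of a metric space $(Y,\rho)$, $r_Y(T):=\inf\{\rho(y,T(y)) : y\in Y\}$. A metric space $Y$ has the approximate fixed point property (AFPP) for nonexpansive mappings if every nonexpansive $T:Y\to Y$ admits a sequence $(u_n)$ in $Y$ with $\rho(u_n,T(u_n))\to0$ (equivalently $r_Y(T)=0$). $(C\times M)_\infty$ is the set $C\times M$ with the metric $d_\infty((x,u),(y,v))=\max\{\rho(x,y),d(u,v)\}$. $P_1:H\to C$ is the coordinate projection onto $C$. Each $T_u$ is nonexpansive. *)

theory Defs
  imports "HOL-Analysis.Analysis"
begin

locale hyperbolic_space = Metric_space X \<rho>
  for X :: "'a set" and \<rho> :: "'a \<Rightarrow> 'a \<Rightarrow> real" +
  fixes W :: "'a \<Rightarrow> 'a \<Rightarrow> real \<Rightarrow> 'a"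
  assumes W_closed: "\<lbrakk>x \<in> X; y \<in> X; l \<in> {0..1}\<rbrakk> \<Longrightarrow> W x y l \<in> X"
    and W1: "\<lbrakk>x \<in> X; y \<in> X; z \<in> X; l \<in> {0..1}\<rbrakk>
      \<Longrightarrow> \<rho> z (W x y l) \<le> (1 - l) * \<rho> z x + l * \<rho> z y"
    and W2: "\<lbrakk>x \<in> X; y \<in> X; l \<in> {0..1}; l' \<in> {0..1}\<rbrakk>
      \<Longrightarrow> \<rho> (W x y l) (W x y l') = \<bar>l - l'\<bar> * \<rho> x y"
    and W3: "\<lbrakk>x \<in> X; y \<in> X; l \<in> {0..1}\<rbrakk> \<Longrightarrow> W x y l = W y x (1 - l)"
    and W4: "\<lbrakk>x \<in> X; y \<in> X; z \<in> X; w \<in> X; l \<in> {0..1}\<rbrakk>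
      \<Longrightarrow> \<rho> (W x z l) (W y w l) \<le> (1 - l) * \<rho> x y + l * \<rho> z w"

definition W_convex :: "('a \<Rightarrow> 'a \<Rightarrow> real \<Rightarrow> 'a) \<Rightarrow> 'a set \<Rightarrow> bool" where
  "W_convex W C \<longleftrightarrow> (\<forall>x\<in>C. \<forall>y\<in>C. \<forall>l\<in>{0..1}. W x y l \<in> C)"

definition nonexpansive ::
  "'a set \<Rightarrow> ('a \<Rightarrow> 'a \<Rightarrow> real) \<Rightarrow> 'b set \<Rightarrow> ('b \<Rightarrow> 'b \<Rightarrow> real) \<Rightarrow> ('a \<Rightarrow> 'b) \<Rightarrow> bool" where
  "nonexpansive Y d Z e f \<longleftrightarrow> f \<in> Y \<rightarrow> Z \<and> (\<forall>x\<in>Y. \<forall>y\<in>Y. e (f x) (f y) \<le> d x y)"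

text \<open>The number \<open>r\<^sub>Y(T)\<close>. It is a real infimum, hence meaningful only for nonempty \<open>Y\<close>
  (the values of \<open>d\<close> are bounded below by 0).\<close>

definition min_displacement :: "'a set \<Rightarrow> ('a \<Rightarrow> 'a \<Rightarrow> real) \<Rightarrow> ('a \<Rightarrow> 'a) \<Rightarrow> real" where
  "min_displacement Y d T = (INF y\<in>Y. d y (T y))"

text \<open>This property forces \<open>Y\<close> to be nonempty, since the identity map needs a sequence in \<open>Y\<close>.\<close>

definition AFPP :: "'a set \<Rightarrow> ('a \<Rightarrow> 'a \<Rightarrow> real) \<Rightarrow> bool" where
  "AFPP Y d \<longleftrightarrow> (\<forall>T. nonexpansive Y d Y d T \<longrightarrow>
     (\<exists>u :: nat \<Rightarrow> 'a. (\<forall>n. u n \<in> Y) \<and> (\<lambda>n. d (u n) (T (u n))) \<longlonglongrightarrow> 0))"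

text \<open>The library metric on products is Euclidean, so the maximum metric is defined here.\<close>

definition max_dist ::
  "('a \<Rightarrow> 'a \<Rightarrow> real) \<Rightarrow> ('b \<Rightarrow> 'b \<Rightarrow> real) \<Rightarrow> 'a \<times> 'b \<Rightarrow> 'a \<times> 'b \<Rightarrow> real" where
  "max_dist \<rho> d p q = max (\<rho> (fst p) (fst q)) (d (snd p) (snd q))"

lemma Metric_space_max_dist:
  assumes "Metric_space C \<rho>" and "Metric_space M d"
  shows "Metric_space (C \<times> M) (max_dist \<rho> d)"
proof -
  interpret A: Metric_space C \<rho> by fact
  interpret B: Metric_space M d by fact
  show ?thesis
  proof
    fix p q :: "'a \<times> 'b"
    show "0 \<le> max_dist \<rho> d p q" by (simp add: max_dist_def le_max_iff_disj)
    show "max_dist \<rho> d p q = max_dist \<rho> d q p"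
      by (simp add: max_dist_def A.commute B.commute)
  next
    fix p q :: "'a \<times> 'b"
    assume "p \<in> C \<times> M" "q \<in> C \<times> M"
    then have *: "\<rho> (fst p) (fst q) = 0 \<longleftrightarrow> fst p = fst q" "d (snd p) (snd q) = 0 \<longleftrightarrow> snd p = snd q"
      by (auto simp: A.zero B.zero)
    have "max_dist \<rho> d p q = 0 \<longleftrightarrow> \<rho> (fst p) (fst q) = 0 \<and> d (snd p) (snd q) = 0"
      using A.nonneg[of "fst p" "fst q"] B.nonneg[of "snd p" "snd q"]
      unfolding max_dist_def by linarith
    then show "max_dist \<rho> d p q = 0 \<longleftrightarrow> p = q"
      using * by (simp add: prod_eq_iff)
  next
    fix p q r :: "'a \<times> 'b"
    assume "p \<in> C \<times> M" "q \<in> C \<times> M" "r \<in> C \<times> M"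
    then have "\<rho> (fst p) (fst r) \<le> \<rho> (fst p) (fst q) + \<rho> (fst q) (fst r)"
      "d (snd p) (snd r) \<le> d (snd p) (snd q) + d (snd q) (snd r)"
      by (auto simp: A.triangle B.triangle)
    then show "max_dist \<rho> d p r \<le> max_dist \<rho> d p q + max_dist \<rho> d q r"
      unfolding max_dist_def by linarith
  qed
qed

definition slice :: "('a \<times> 'b \<Rightarrow> 'a \<times> 'b) \<Rightarrow> 'b \<Rightarrow> 'a \<Rightarrow> 'a" where
  "slice T u x = fst (T (x, u))"

end

theory Submission
  imports Defs
begin

text \<open>
  Iterate the averaged maps \<open>x \<mapsto> W x (T\<^sub>u x) (1/2)\<close> starting from \<open>\<delta> u\<close>. By (W4) each iterate
  \<open>x\<^sub>n(u)\<close> is a nonexpansive function of \<open>u\<close>, so \<open>u \<mapsto> P\<^sub>2 (T (x\<^sub>n(u), u))\<close> is a nonexpansive self-map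
  of \<open>M\<close> and has approximate fixed points. It remains to find one index \<open>n\<close> for which
  \<open>\<rho> (x\<^sub>n(u)) (T\<^sub>u (x\<^sub>n(u)))\<close> is at most the supremum plus \<open>2\<epsilon>\<close>, simultaneously for all \<open>u\<close>. This is a
  uniform version of a theorem of Borwein, Reich and Shafrir: by the Goebel-Kirk inequality,
  an orbit whose displacement stays almost constant over a long block moves away almost linearly,
  whereas it has to stay within distance \<open>\<phi> \<epsilon>\<close> from the orbit of \<open>x\<^sup>*\<close>, which moves slowly.
\<close>

locale averaged_map = hyperbolic_space X \<rho> W
  for X :: "'a set" and \<rho> :: "'a \<Rightarrow> 'a \<Rightarrow> real" and W :: "'a \<Rightarrow> 'a \<Rightarrow> real \<Rightarrow> 'a" +
  fixes C :: "'a set" and S :: "'a \<Rightarrow> 'a"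
  assumes sub: "C \<subseteq> X" and conv: "W_convex W C" and ne: "nonexpansive C \<rho> C \<rho> S"
begin

definition A :: "'a \<Rightarrow> 'a" where "A x = W x (S x) (1/2)"

abbreviation disp :: "'a \<Rightarrow> real" where "disp x \<equiv> \<rho> x (S x)"

lemma S_closed: "x \<in> C \<Longrightarrow> S x \<in> C"
  using ne by (auto simp: nonexpansive_def)

lemma S_le: "x \<in> C \<Longrightarrow> y \<in> C \<Longrightarrow> \<rho> (S x) (S y) \<le> \<rho> x y"
  using ne by (auto simp: nonexpansive_def)

lemma A_closed: "x \<in> C \<Longrightarrow> A x \<in> C"
  using conv S_closed by (auto simp: A_def W_convex_def)

lemma iter_closed: "x \<in> C \<Longrightarrow> (A ^^ n) x \<in> C"
  by (induction n) (auto simp: A_closed)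

lemma in_X: "x \<in> C \<Longrightarrow> x \<in> X"
  using sub by blast

lemma dist_A_le:
  assumes "x \<in> C" "z \<in> C"
  shows "\<rho> z (A x) \<le> \<rho> z x / 2 + \<rho> z (S x) / 2"
  using W1[of x "S x" z "1/2"] assms by (simp add: A_def in_X S_closed)

lemma dist_A_self: "x \<in> C \<Longrightarrow> \<rho> x (A x) \<le> disp x / 2"
  using dist_A_le[of x x] by (simp add: in_X)

lemma A_le:
  assumes "x \<in> C" "y \<in> C"
  shows "\<rho> (A x) (A y) \<le> \<rho> x y"
  using W4[of x y "S x" "S y" "1/2"] assms S_le[of x y] by (simp add: A_def in_X S_closed)

lemma iter_le:
  assumes "x \<in> C" "y \<in> C"
  shows "\<rho> ((A ^^ n) x) ((A ^^ n) y) \<le> \<rho> x y"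
proof (induction n)
  case (Suc n)
  then show ?case
    using A_le[of "(A ^^ n) x" "(A ^^ n) y"] iter_closed assms by fastforce
qed simp

text \<open>By (W1), \<open>A x\<close> lies within \<open>disp x / 2\<close> of both
  \<open>x\<close> and \<open>S x\<close>. The first bound passes through \<open>S\<close>, and the
  triangle inequality via \<open>S x\<close> adds the two halves.\<close>

lemma disp_A_le:
  assumes "x \<in> C"
  shows "disp (A x) \<le> disp x"
proof -
  have "disp (A x) \<le> \<rho> (A x) (S x) + \<rho> (S x) (S (A x))"
    by (intro triangle) (simp_all add: assms in_X A_closed S_closed)
  moreover have "\<rho> (S x) (S (A x)) \<le> disp x / 2"
    using S_le[of x "A x"] dist_A_self[of x] A_closed assms by fastforce
  moreover have "\<rho> (A x) (S x) \<le> disp x / 2"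
    using dist_A_le[of x "S x"] assms by (simp add: in_X S_closed commute)
  ultimately show ?thesis by linarith
qed

lemma disp_iter_antimono:
  assumes "x \<in> C" "m \<le> n"
  shows "disp ((A ^^ n) x) \<le> disp ((A ^^ m) x)"
  using assms(2)
proof (induction n rule: dec_induct)
  case (step n)
  then show ?case using disp_A_le[of "(A ^^ n) x"] iter_closed[OF assms(1)] by fastforce
qed simp

lemma dist_iter_le:
  assumes "x \<in> C"
  shows "\<rho> x ((A ^^ n) x) \<le> real n / 2 * disp x"
proof (induction n)
  case 0
  then show ?case using assms by (simp add: in_X)
next
  case (Suc n)
  have "\<rho> x ((A ^^ Suc n) x) \<le> \<rho> x ((A ^^ n) x) + \<rho> ((A ^^ n) x) (A ((A ^^ n) x))"
    using triangle assms by (simp add: in_X iter_closed A_closed)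
  moreover have "\<rho> ((A ^^ n) x) (A ((A ^^ n) x)) \<le> disp x / 2"
    using dist_A_self[OF iter_closed[OF assms, of n]] disp_iter_antimono[OF assms, of 0 n] by simp
  ultimately show ?case using Suc by (simp add: field_simps)
qed

text \<open>Induction from the front of the orbit: the hypothesis at \<open>A x\<close> bounds
  \<rho> y (A x) from below for the same endpoint y, and (W1) turns this into a bound on \<rho> x y
  at the cost of \<rho> y (S x). Solving for \<rho> x y doubles the coefficients, hence the power of
  2.\<close>

lemma Goebel_Kirk:
  assumes "x \<in> C"
  shows "2 ^ n * (disp ((A ^^ n) x) - disp x) + (1 + real n / 2) * disp x \<le> \<rho> x (S ((A ^^ n) x))"
  using assms
proof (induction n arbitrary: x)
  case 0
  then show ?case by simp
next
  case (Suc n)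
  define y where "y = S ((A ^^ Suc n) x)"
  have yC: "y \<in> C" unfolding y_def by (intro S_closed iter_closed Suc.prems)
  have IH: "2 ^ n * (disp ((A ^^ Suc n) x) - disp (A x)) + (1 + real n / 2) * disp (A x) \<le> \<rho> y (A x)"
    using Suc.IH[OF A_closed[OF Suc.prems]] by (simp add: y_def funpow_swap1 commute)
  have up: "\<rho> y (A x) \<le> \<rho> x y / 2 + \<rho> y (S x) / 2"
    using dist_A_le[OF Suc.prems yC] by (simp add: commute)
  have "\<rho> y (S x) \<le> \<rho> x ((A ^^ Suc n) x)"
    unfolding y_def using S_le[OF Suc.prems iter_closed[OF Suc.prems]] by (metis commute)
  also have "\<dots> \<le> (real n + 1) / 2 * disp x"
    using dist_iter_le[OF Suc.prems, of "Suc n"] by (simp add: add.commute)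
  finally have Sx: "\<rho> y (S x) \<le> (real n + 1) / 2 * disp x" .
  have "real n + 2 \<le> 2 ^ Suc n"
    by (induction n) auto
  \<comment> \<open>This product is exactly the surplus left when \<open>disp (A x)\<close> is
    replaced by \<open>disp x\<close> in the doubled hypothesis.\<close>
  then have "0 \<le> (2 ^ Suc n - (real n + 2)) * (disp x - disp (A x))"
    using disp_A_le[OF Suc.prems] by (intro mult_nonneg_nonneg) auto
  with IH up Sx show ?case
    unfolding y_def[symmetric] by (simp add: algebra_simps add_divide_distrib)
qed

text \<open>With so small a drop, the exponential term of \<open>Goebel_Kirk\<close> costs at most
  1, so \<open>S ((A ^^ n) x)\<close> is at least (1 + n/2) \<open>disp x\<close> - 1 away from x.
  The detour along the orbit of y bounds the same distance by 2b + n\<gamma>/2 +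
  \<open>disp x\<close>.\<close>

lemma disp_le_of_small_drop:
  assumes "x \<in> C" "y \<in> C" and "\<rho> x y \<le> b" and "disp y \<le> \<gamma>"
    and "disp x - disp ((A ^^ n) x) \<le> 1 / 2 ^ n"
  shows "real n / 2 * (disp x - \<gamma>) \<le> 2 * b + 1"
proof -
  let ?x = "(A ^^ n) x" and ?y = "(A ^^ n) y"
  have C: "?x \<in> C" "?y \<in> C" using assms iter_closed by auto
  note X = C[THEN in_X] assms(1,2)[THEN in_X]
  have "\<rho> y ?y \<le> real n / 2 * disp y" by (rule dist_iter_le) fact
  also have "\<dots> \<le> real n / 2 * \<gamma>" using assms(4) by (intro mult_left_mono) auto
  finally have "\<rho> y ?y \<le> real n / 2 * \<gamma>" .
  moreover have "\<rho> ?x ?y \<le> b" using iter_le[OF assms(1,2)] assms(3) by (rule order_trans)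
  moreover have "\<rho> x ?x \<le> \<rho> x y + \<rho> y ?x" "\<rho> y ?x \<le> \<rho> y ?y + \<rho> ?y ?x"
    using X by (auto intro: triangle)
  moreover have "\<rho> x (S ?x) \<le> \<rho> x ?x + disp ?x"
    using X C by (auto intro!: triangle in_X S_closed)
  moreover have "disp ?x \<le> disp x" using disp_iter_antimono[OF assms(1), of 0 n] by simp
  moreover have "2 ^ n * (disp x - disp ?x) \<le> 1" using assms(5) by (simp add: field_simps)
  moreover note Goebel_Kirk[OF assms(1), of n]
  ultimately show ?thesis using assms(3) by (simp add: commute[of ?y] algebra_simps)
qed

end

lemma small_drop_exists:
  fixes f :: "nat \<Rightarrow> real"
  assumes "f 0 - f J < real J * \<eta>"
  shows "\<exists>j<J. f j - f (Suc j) \<le> \<eta>"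
proof (rule ccontr)
  assume "\<not> ?thesis"
  then have "(\<Sum>j<J. \<eta>) \<le> (\<Sum>j<J. f j - f (Suc j))" by (intro sum_mono) (auto simp: not_le less_imp_le)
  with assms show False by (simp add: sum_lessThan_telescope')
qed

text \<open>The order of quantifiers is the point: N depends only on b, \<gamma> and \<epsilon>, so
  one index serves all slices of T.\<close>

lemma (in hyperbolic_space) uniform_Borwein_Reich_Shafrir:
  assumes "\<epsilon> > 0"
  shows "\<exists>N. \<forall>C S x y. averaged_map X \<rho> W C S \<longrightarrow> x \<in> C \<longrightarrow> y \<in> C \<longrightarrow> \<rho> x y \<le> b \<longrightarrow> \<rho> y (S y) \<le> \<gamma> \<longrightarrow>
    \<rho> ((averaged_map.A W S ^^ N) x) (S ((averaged_map.A W S ^^ N) x)) \<le> \<gamma> + \<epsilon>"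
proof -
  \<comment> \<open>The block length n makes \<open>disp_le_of_small_drop\<close> yield an excess
    below \<epsilon>.\<close>
  obtain n where "(2 * b + 1) * 2 / \<epsilon> < real n" using reals_Archimedean2 by blast
  then have n: "2 * b + 1 < real n / 2 * \<epsilon>" using assms by (simp add: field_simps)
  \<comment> \<open>The displacement of x is at most 2b + \<gamma>, so it cannot fall by more than
    \<open>1 / 2 ^ n\<close> in each of J blocks.\<close>
  obtain J where "(2 * b + \<gamma>) * 2 ^ n < real J" using reals_Archimedean2 by blast
  then have J: "2 * b + \<gamma> < real J * (1 / 2 ^ n)" by (simp add: field_simps)
  show ?thesis
  proof (intro exI[of _ "J * n"] allI impI)
    fix C S x y
    assume "averaged_map X \<rho> W C S" and xC: "x \<in> C" and yC: "y \<in> C"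
      and b: "\<rho> x y \<le> b" and \<gamma>: "\<rho> y (S y) \<le> \<gamma>"
    then interpret averaged_map X \<rho> W C S by simp
    have "disp x \<le> \<rho> x y + \<rho> y (S x)" "\<rho> y (S x) \<le> disp y + \<rho> (S y) (S x)"
      using xC yC by (auto intro!: triangle in_X S_closed)
    then have "disp x \<le> 2 * b + \<gamma>"
      using S_le[OF yC xC] b \<gamma> commute[of x y] by linarith
    then have "disp ((A ^^ (0 * n)) x) - disp ((A ^^ (J * n)) x) < real J * (1 / 2 ^ n)"
      using J nonneg[of "(A ^^ (J * n)) x"] by (smt (verit) funpow_0 mult_0)
    from small_drop_exists[where f = "\<lambda>j. disp ((A ^^ (j * n)) x)", OF this] obtain j where j: "j < J"
      and drop: "disp ((A ^^ (j * n)) x) - disp ((A ^^ (Suc j * n)) x) \<le> 1 / 2 ^ n" by blast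
    let ?x = "(A ^^ (j * n)) x" and ?y = "(A ^^ (j * n)) y"
    \<comment> \<open>The bounds b and \<gamma> survive iteration, so the good block may start
      anywhere. Its index j depends on S and x, but monotonicity carries the estimate to the common
      index \<open>J * n\<close>.\<close>
    have "\<rho> ?x ?y \<le> b" using iter_le[OF xC yC] b by (rule order_trans)
    moreover have "disp ?y \<le> \<gamma>" using disp_iter_antimono[OF yC, of 0 "j * n"] \<gamma> by simp
    moreover have "disp ?x - disp ((A ^^ n) ?x) \<le> 1 / 2 ^ n"
      using drop by (simp add: funpow_add)
    ultimately have "real n / 2 * (disp ?x - \<gamma>) \<le> 2 * b + 1"
      by (intro disp_le_of_small_drop[of ?x ?y]) (auto simp: iter_closed xC yC)
    also note n
    finally have "disp ?x - \<gamma> < \<epsilon>" by (rule mult_left_less_imp_less) simp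
    moreover have "disp ((A ^^ (J * n)) x) \<le> disp ?x"
      using j by (intro disp_iter_antimono xC) simp
    ultimately show "disp ((A ^^ (J * n)) x) \<le> \<gamma> + \<epsilon>" by simp
  qed
qed

theorem theorem2p3:
  fixes X C :: "'a set" and \<rho> :: "'a \<Rightarrow> 'a \<Rightarrow> real" and W :: "'a \<Rightarrow> 'a \<Rightarrow> real \<Rightarrow> 'a"
    and M :: "'b set" and d :: "'b \<Rightarrow> 'b \<Rightarrow> real"
    and \<delta> :: "'b \<Rightarrow> 'a" and T :: "'a \<times> 'b \<Rightarrow> 'a \<times> 'b" and \<phi> :: "real \<Rightarrow> real"
  assumes "hyperbolic_space X \<rho> W"
    and "C \<subseteq> X" and "C \<noteq> {}" and "W_convex W C"
    and "Metric_space M d" and "AFPP M d"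
    and "nonexpansive M d C \<rho> \<delta>"
    and "nonexpansive (C \<times> M) (max_dist \<rho> d) (C \<times> M) (max_dist \<rho> d) T"
    and "bdd_above ((\<lambda>u. min_displacement C \<rho> (slice T u)) ` M)"
    and "\<And>\<epsilon>. \<epsilon> > 0 \<Longrightarrow> \<phi> \<epsilon> > 0"
    and "\<And>\<epsilon> v. \<epsilon> > 0 \<Longrightarrow> v \<in> M \<Longrightarrow>
      \<exists>x\<in>C. \<rho> (\<delta> v) x \<le> \<phi> \<epsilon> \<and>
        \<rho> x (slice T v x) \<le> (SUP u\<in>M. min_displacement C \<rho> (slice T u)) + \<epsilon>"
  shows "min_displacement (C \<times> M) (max_dist \<rho> d) T
    \<le> (SUP u\<in>M. min_displacement C \<rho> (slice T u))"
proof -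
  interpret hyperbolic_space X \<rho> W by fact
  interpret M: Metric_space M d by fact
  note T = assms(8)[unfolded nonexpansive_def]
  have TC: "fst (T (x, u)) \<in> C" and TM: "snd (T (x, u)) \<in> M" if "x \<in> C" "u \<in> M" for x u
    using T that by (auto simp: Pi_iff mem_Times_iff)
  have T_le: "\<rho> (fst (T (x, u))) (fst (T (y, v))) \<le> max (\<rho> x y) (d u v)"
    "d (snd (T (x, u))) (snd (T (y, v))) \<le> max (\<rho> x y) (d u v)"
    if "x \<in> C" "u \<in> M" "y \<in> C" "v \<in> M" for x y u v
  proof -
    have "max_dist \<rho> d (T (x, u)) (T (y, v)) \<le> max_dist \<rho> d (x, u) (y, v)"
      using T that by blast
    then show "\<rho> (fst (T (x, u))) (fst (T (y, v))) \<le> max (\<rho> x y) (d u v)"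
      "d (snd (T (x, u))) (snd (T (y, v))) \<le> max (\<rho> x y) (d u v)"
      by (simp_all add: max_dist_def)
  qed
  have avg: "averaged_map X \<rho> W C (slice T u)" if "u \<in> M" for u
  proof
    show "nonexpansive C \<rho> C \<rho> (slice T u)"
      unfolding nonexpansive_def slice_def
    proof (intro conjI ballI)
      fix x y assume "x \<in> C" "y \<in> C"
      then show "\<rho> (fst (T (x, u))) (fst (T (y, u))) \<le> \<rho> x y"
        using T_le(1)[of x u y u] that by simp
    qed (use TC that in blast)
  qed fact+
  define s where "s = (SUP u\<in>M. min_displacement C \<rho> (slice T u))"
  define q where "q n u = (averaged_map.A W (slice T u) ^^ n) (\<delta> u)" for n u
  have q_Suc: "q (Suc n) u = W (q n u) (fst (T (q n u, u))) (1/2)" if "u \<in> M" for n u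
    using averaged_map.A_def[OF avg[OF that]] by (simp add: q_def slice_def)
  have \<delta>C: "\<delta> u \<in> C" if "u \<in> M" for u
    using assms(7) that by (auto simp: nonexpansive_def)
  have qC: "q n u \<in> C" if "u \<in> M" for n u
    unfolding q_def by (rule averaged_map.iter_closed[OF avg[OF that] \<delta>C[OF that]])
  \<comment> \<open>The maximum metric is essential: by induction the maximum in \<open>T_le\<close>
    is just d u v, and (W4) averages two quantities bounded by it.\<close>
  have q_le: "\<rho> (q n u) (q n v) \<le> d u v" if "u \<in> M" "v \<in> M" for n u v
  proof (induction n)
    case 0
    then show ?case using assms(7) that by (simp add: q_def nonexpansive_def)
  next
    case (Suc n)
    have "\<rho> (q (Suc n) u) (q (Suc n) v)
      \<le> (1 - 1/2) * \<rho> (q n u) (q n v) + 1/2 * \<rho> (fst (T (q n u, u))) (fst (T (q n v, v)))"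
      unfolding q_Suc[OF that(1)] q_Suc[OF that(2)]
      using that qC TC assms(2) by (intro W4) auto
    then show ?case
      using Suc T_le(1)[of "q n u" u "q n v" v] that qC by auto
  qed
  have "min_displacement (C \<times> M) (max_dist \<rho> d) T \<le> s + 2 * \<epsilon>" if \<epsilon>: "\<epsilon> > 0" for \<epsilon>
  proof -
    obtain N where N: "\<And>C S x y. averaged_map X \<rho> W C S \<Longrightarrow> x \<in> C \<Longrightarrow> y \<in> C \<Longrightarrow>
        \<rho> x y \<le> \<phi> \<epsilon> \<Longrightarrow> \<rho> y (S y) \<le> s + \<epsilon> \<Longrightarrow>
        \<rho> ((averaged_map.A W S ^^ N) x) (S ((averaged_map.A W S ^^ N) x)) \<le> s + \<epsilon> + \<epsilon>"
      using uniform_Borwein_Reich_Shafrir[OF \<epsilon>, of "\<phi> \<epsilon>" "s + \<epsilon>"] by blast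
    have "nonexpansive M d M d (\<lambda>u. snd (T (q N u, u)))"
      unfolding nonexpansive_def
    proof (intro conjI ballI)
      fix u v assume "u \<in> M" "v \<in> M"
      then show "d (snd (T (q N u, u))) (snd (T (q N v, v))) \<le> d u v"
        using T_le(2)[of "q N u" u "q N v" v] q_le[of u v N] qC by simp
    qed (use TM qC in blast)
    then obtain v where v: "\<And>n. v n \<in> M" "(\<lambda>n. d (v n) (snd (T (q N (v n), v n)))) \<longlonglongrightarrow> 0"
      using assms(6) unfolding AFPP_def by blast
    from order_tendstoD(2)[OF v(2) \<epsilon>] obtain n where "d (v n) (snd (T (q N (v n), v n))) < \<epsilon>"
      by (auto simp: eventually_sequentially)
    moreover define u where "u = v n"
    ultimately have u: "u \<in> M" and du: "d u (snd (T (q N u, u))) < \<epsilon>" using v(1) by auto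
    obtain x where x: "x \<in> C" "\<rho> (\<delta> u) x \<le> \<phi> \<epsilon>" "\<rho> x (slice T u x) \<le> s + \<epsilon>"
      using assms(11)[OF \<epsilon> u] unfolding s_def by blast
    have "\<rho> (q N u) (slice T u (q N u)) \<le> s + \<epsilon> + \<epsilon>"
      unfolding q_def by (rule N[OF avg[OF u] \<delta>C[OF u] x])
    \<comment> \<open>This gives \<epsilon> \<le> s + 2\<epsilon>, which covers the second
      coordinate in the maximum.\<close>
    moreover have "0 \<le> s + \<epsilon>" using x(3) nonneg[of x "slice T u x"] by linarith
    ultimately have "max_dist \<rho> d (q N u, u) (T (q N u, u)) \<le> s + 2 * \<epsilon>"
      using du by (simp add: max_dist_def slice_def)
    moreover have "min_displacement (C \<times> M) (max_dist \<rho> d) T \<le> max_dist \<rho> d (q N u, u) (T (q N u, u))"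
      unfolding min_displacement_def
      by (rule cINF_lower) (auto simp: qC u max_dist_def le_max_iff_disj intro!: bdd_belowI[of _ 0])
    ultimately show ?thesis by linarith
  qed
  then have "min_displacement (C \<times> M) (max_dist \<rho> d) T \<le> s + e" if "e > 0" for e
    using that by (metis field_sum_of_halves half_gt_zero mult_2)
  then show ?thesis
    unfolding s_def[symmetric] by (rule field_le_epsilon)
qed

end
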